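(* Consider the $m$-person noncooperative game with strategy sets $X_k\subseteq\mathbb{R}^{r_k}$ and cost functions $f_k$ ($k\in[m]$) described in the context. Suppose that every $X_k\subseteq\mathbb{R}^{r_k}$, $k\in[m]$, is closed and convex. Then a tuple $x^*=((x^1)^*,(x^2)^*,\ldots,(x^m)^* )$ is a Nash equilibrium point of the $m$-person noncooperative game if and only if $x^*$ is a solution of the variational inequality VI$(X,F)$ with $X=\prod_{j\in[m]}X_j$ and $F(x)=\left(\nabla_{x^k}f_k(x^k,x^{-k})\right)_{k\in[m]}$, where $\nabla_{x^k}f_k(x^k,x^{-k})$ is the gradient of $f_k$ with respect to $x^k$.
   Context: $[m]:=\{1,\ldots,m\}$. The game has $m$ players, where $m$ and $r_1,\ldots,r_m$ are positive integers. For each $k\in[m]$, $x^k\in\mathbb{R}^{r_k}$ is player $k$'s strategy and $X_k\subseteq\mathbb{R}^{r_k}$ is his (nonempty) strategy set. Write $n=\sum_{j\in[m]}r_j$, $x=(x^j)_{j\in[m]}\in\mathbb{R}^{r_1}\times\cdots\times\mathbb{R}^{r_m}=\mathbb{R}^n$, $x^{-k}=(x^j)_{j\in[m]\setminus\{k\}}$, and $X=\prod_{j\in[m]}X_j\subseteq\mathbb{R}^n$. Player $k$ has a payoff tensor $\mathcal{A}^k=(a^k_{i_1i_2\cdots i_m})$ with real entries, $i_j\in[r_j]$ for $j\in[m]$, and his cost function is $f_k(x^k,x^{-k})=\sum_{i_1=1}^{r_1}\sum_{i_2=1}^{r_2}\cdots\sum_{i_m=1}^{r_m}a^k_{i_1i_2\cdots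 i_m}x^1_{i_1}x^2_{i_2}\cdots x^m_{i_m}$, which each player tries to minimize over his own strategy. A tuple $x^*=((x^1)^*,\ldots,(x^m)^* )$ is a Nash equilibrium point of the game if, for every $k\in[m]$, $(x^k)^*\in\arg\min_{x^k\in X_k}f_k(x^k,(x^* )^{-k})$, where $(x^* )^{-k}=((x^j)^* )_{j\in[m]\setminus\{k\}}$. For $X\subseteq\mathbb{R}^n$ nonempty and $F$ with values in $\mathbb{R}^n$, VI$(X,F)$ is the problem of finding $x^*\in X$ such that $\langle y-x^*,F(x^* )\rangle\ge 0$ for all $y\in X$. *)

theory Defs
  imports "HOL-Analysis.Analysis"
begin

text \<open>
  The players are the elements of a finite type \<open>'m\<close>, so \<open>m = CARD('m)\<close>. The dimensions \<open>r\<^sub>k\<close>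
  may differ from player to player: the index set \<open>{1..r\<^sub>k}\<close> is rendered as a nonempty set
  \<open>J k\<close> of \<open>r\<^sub>k = card (J k)\<close> elements of one finite type \<open>'n\<close>, and the space of player \<open>k\<close> as the
  coordinate subspace of \<open>real^'n\<close> of the vectors that vanish outside \<open>J k\<close>, with the inherited
  inner product and topology. As \<open>'n\<close> is arbitrary, all families of dimensions are covered.
  A tuple of strategies is a \<open>x :: real^'n^'m\<close> whose \<open>k\<close>-th block is \<open>x $ k\<close>; the inner product of
  this type is the sum over the blocks, hence that of the product of the strategy spaces.
\<close>

definition strategy_space :: "'n set \<Rightarrow> (real^'n) set" where
  "strategy_space I = {v. \<forall>i. i \<notin> I \<longrightarrow> v $ i = 0}"

text \<open>
  A tensor is a function of a multi-index \<open>i\<close> choosing \<open>i k \<in> J k\<close> for every player \<open>k\<close>; only its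
  values at such multi-indices are used.
\<close>

definition multilinear_form ::
    "('m::finite \<Rightarrow> 'n::finite set) \<Rightarrow> (('m \<Rightarrow> 'n) \<Rightarrow> real) \<Rightarrow> real^'n^'m \<Rightarrow> real" where
  "multilinear_form J A x = (\<Sum>i \<in> {i. \<forall>k. i k \<in> J k}. A i * (\<Prod>j\<in>UNIV. x $ j $ i j))"

definition replace_block :: "'a^'m \<Rightarrow> 'm \<Rightarrow> 'a \<Rightarrow> 'a^'m" where
  "replace_block x k v = (\<chi> j. if j = k then v else x $ j)"

text \<open>
  \<open>cost J a k v x\<close> is the cost of player \<open>k\<close> when he plays \<open>v\<close> and the others play according to \<open>x\<close>;
  the block \<open>x $ k\<close> is not used.
\<close>

definition cost ::
    "('m::finite \<Rightarrow> 'n::finite set) \<Rightarrow> ('m \<Rightarrow> ('m \<Rightarrow> 'n) \<Rightarrow> real)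
      \<Rightarrow> 'm \<Rightarrow> real^'n \<Rightarrow> real^'n^'m \<Rightarrow> real" where
  "cost J a k v x = multilinear_form J (a k) (replace_block x k v)"

definition nash_equilibrium ::
    "('m::finite \<Rightarrow> 'n::finite set) \<Rightarrow> ('m \<Rightarrow> ('m \<Rightarrow> 'n) \<Rightarrow> real)
      \<Rightarrow> ('m \<Rightarrow> (real^'n) set) \<Rightarrow> real^'n^'m \<Rightarrow> bool" where
  "nash_equilibrium J a X x \<longleftrightarrow>
     (\<forall>k. is_arg_min (\<lambda>v. cost J a k v x) (\<lambda>v. v \<in> X k) (x $ k))"

definition gradient :: "('a::real_inner \<Rightarrow> real) \<Rightarrow> 'a \<Rightarrow> 'a" where
  "gradient f x = (THE D. GDERIV f x :> D)"

text \<open>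
  The cost of player \<open>k\<close> depends only on the coordinates in \<open>J k\<close> of his strategy, so the gradient
  taken in \<open>real^'n\<close> lies in \<open>strategy_space (J k)\<close> and is the gradient in that space.
\<close>

definition game_map ::
    "('m::finite \<Rightarrow> 'n::finite set) \<Rightarrow> ('m \<Rightarrow> ('m \<Rightarrow> 'n) \<Rightarrow> real)
      \<Rightarrow> real^'n^'m \<Rightarrow> real^'n^'m" where
  "game_map J a x = (\<chi> k. gradient (\<lambda>v. cost J a k v x) (x $ k))"

definition block_product :: "('m \<Rightarrow> 'a set) \<Rightarrow> ('a^'m) set" where
  "block_product X = {x. \<forall>k. x $ k \<in> X k}"

definition VI_solution :: "'a::real_inner set \<Rightarrow> ('a \<Rightarrow> 'a) \<Rightarrow> 'a \<Rightarrow> bool" where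
  "VI_solution X F x \<longleftrightarrow> x \<in> X \<and> (\<forall>y\<in>X. inner (y - x) (F x) \<ge> 0)"

end

(* A multilinear form is linear in each single block, so each player's cost equals
   v \<mapsto> \<langle>v, c\<rangle> with c its gradient; minimality of x^k on X_k then reads
   \<langle>v - x^k, c\<rangle> \<ge> 0 for all v \<in> X_k. As X is a product, these m inequalities hold
   exactly when their sum does: vary one block at a time. *)

theory Submission
  imports Defs
begin

text \<open>Each monomial contains exactly one factor from block \<open>k\<close>, namely
  \<open>v $ i k\<close>; the remaining factors form a coefficient independent of
  \<open>v\<close>.\<close>

lemma linear_multilinear_form_replace_block:
  "linear (\<lambda>v. multilinear_form J A (replace_block x k v))"
proof -
  have "(\<Prod>j\<in>UNIV. replace_block x k v $ j $ i j) = (\<Prod>j\<in>UNIV - {k}. x $ j $ i j) * v $ i k"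
    for v i
    by (subst prod.remove[of _ k]) (simp_all add: replace_block_def)
  then show ?thesis
    unfolding multilinear_form_def
    by (intro linearI)
      (simp_all add: algebra_simps sum.distrib sum_distrib_left)
qed

text \<open>Since \<open>gradient\<close> is a definite description, uniqueness is at stake: the
  derivative of \<open>f\<close> at \<open>x\<close> is unique, and as a functional it determines
  its representing vector.\<close>

lemma gradient_eqI:
  assumes "GDERIV f x :> D"
  shows "gradient f x = D"
  unfolding gradient_def
proof (rule the_equality)
  show "E = D" if "GDERIV f x :> E" for E
  proof -
    have "(\<lambda>h. inner h E) = (\<lambda>h. inner h D)"
      using that assms unfolding gderiv_def by (rule has_derivative_unique)
    then show ?thesis
      by (metis vector_eq_ldot)
  qed
qed (fact assms)

text \<open>A linear functional is its own derivative at every point, and its Riesz vector is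
  \<open>adjoint f 1\<close>, which is therefore the gradient everywhere.\<close>

lemma gradient_linear:
  fixes f :: "'a::euclidean_space \<Rightarrow> real"
  assumes "linear f"
  shows "inner v (gradient f x) = f v"
proof -
  have f: "f = (\<lambda>v. inner v (adjoint f 1))"
    using adjoint_works[OF assms, of _ 1] by (simp add: fun_eq_iff)
  have "GDERIV f x :> adjoint f 1"
    unfolding gderiv_def
    using linear_imp_has_derivative[OF assms] f by metis
  then show ?thesis
    using f by (metis gradient_eqI)
qed

lemma VI_solution_block_product_iff:
  fixes x :: "'a::real_inner^'m::finite"
  shows "VI_solution (block_product X) F x \<longleftrightarrow>
    (\<forall>k. x $ k \<in> X k \<and> (\<forall>v\<in>X k. inner (v - x $ k) (F x $ k) \<ge> 0))"
proof
  assume VI: "VI_solution (block_product X) F x"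
  show "\<forall>k. x $ k \<in> X k \<and> (\<forall>v\<in>X k. inner (v - x $ k) (F x $ k) \<ge> 0)"
  proof (intro allI conjI ballI)
    show x_in: "x $ k \<in> X k" for k
      using VI by (simp add: VI_solution_def block_product_def)
    fix k v
    assume "v \<in> X k"
    then have "replace_block x k v \<in> block_product X"
      using x_in by (simp add: block_product_def replace_block_def)
    then have "0 \<le> inner (replace_block x k v - x) (F x)"
      using VI by (simp add: VI_solution_def)
    \<comment> \<open>The test point agrees with \<open>x\<close> outside block \<open>k\<close>, so
      only the \<open>k\<close>-th summand of the inner product survives.\<close>
    also have "\<dots> = (\<Sum>j\<in>UNIV. if j = k then inner (v - x $ k) (F x $ k) else 0)"
      unfolding inner_vec_def by (rule sum.cong) (simp_all add: replace_block_def)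
    finally show "inner (v - x $ k) (F x $ k) \<ge> 0"
      by simp
  qed
next
  assume "\<forall>k. x $ k \<in> X k \<and> (\<forall>v\<in>X k. inner (v - x $ k) (F x $ k) \<ge> 0)"
  then show "VI_solution (block_product X) F x"
    by (auto simp: VI_solution_def block_product_def inner_vec_def intro!: sum_nonneg)
qed

theorem proposition3p2:
  fixes J :: "'m::finite \<Rightarrow> 'n::finite set"
    and a :: "'m \<Rightarrow> ('m \<Rightarrow> 'n) \<Rightarrow> real"
    and X :: "'m \<Rightarrow> (real^'n) set"
    and x :: "real^'n^'m"
  assumes "\<And>k. J k \<noteq> {}"
    and "\<And>k. X k \<subseteq> strategy_space (J k)"
    and "\<And>k. X k \<noteq> {}"
    and "\<And>k. closed (X k)"
    and "\<And>k. convex (X k)"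
  shows "nash_equilibrium J a X x \<longleftrightarrow> VI_solution (block_product X) (game_map J a) x"
proof -
  have "linear (\<lambda>v. cost J a k v x)" for k
    unfolding cost_def by (rule linear_multilinear_form_replace_block)
  \<comment> \<open>By linearity this is the exact change of cost, not just its first-order part, so
    its nonnegativity on \<open>X k\<close> is minimality itself.\<close>
  then have "inner (v - x $ k) (game_map J a x $ k) = cost J a k v x - cost J a k (x $ k) x" for k v
    by (simp add: game_map_def gradient_linear flip: linear_diff[where f="\<lambda>v. cost J a k v x"])
  then show ?thesis
    by (auto simp: VI_solution_block_product_iff nash_equilibrium_def is_arg_min_def not_less)
qed

end
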